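(* As $x\to\infty$ (i.e. for all sufficiently large real $x$), one has $$\big|\{n\leqslant x:\ P^+(n-1)>P^+(n)<P^+(n+1)\}\big|>1{,}063\times 10^{-7}\,x$$ and $$\big|\{n\leqslant x:\ P^+(n-1)<P^+(n)>P^+(n+1)\}\big|>8{,}84\times 10^{-4}\,x.$$
   Context: $n$ ranges over positive integers. For an integer $n\geqslant 1$, $P^+(n)$ denotes the largest prime factor of $n$, with the convention $P^+(1)=1$. Decimal commas are used: $1{,}063=1.063$, $8{,}84=8.84$. *)

theory Defs
  imports Complex_Main "HOL-Computational_Algebra.Primes"
begin

text \<open>The largest prime factor, with the convention that it is 1 at 1.  The value at 0 is
  unspecified; it is never used.\<close>

definition largest_prime_factor :: "nat \<Rightarrow> nat" where
  "largest_prime_factor n = (if n = 1 then 1 else Max (prime_factors n))"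

text \<open>The sets below start at \<open>n = 2\<close>, the first \<open>n\<close> at which the largest prime factors of
  all three of \<open>n - 1\<close>, \<open>n\<close>, \<open>n + 1\<close> are defined.\<close>

definition valleys_upto :: "real \<Rightarrow> nat set" where
  "valleys_upto x = {n. 2 \<le> n \<and> real n \<le> x \<and>
     largest_prime_factor (n - 1) > largest_prime_factor n \<and>
     largest_prime_factor n < largest_prime_factor (n + 1)}"

definition peaks_upto :: "real \<Rightarrow> nat set" where
  "peaks_upto x = {n. 2 \<le> n \<and> real n \<le> x \<and>
     largest_prime_factor (n - 1) < largest_prime_factor n \<and>
     largest_prime_factor n > largest_prime_factor (n + 1)}"

end

(* Write P for the largest prime factor.  Every maximal block of consecutive integers n <= x with
   P(n) > x^(7/10) contains a peak, so it suffices that these integers have positive density and do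
   not clump into long blocks.  The density is a sum of reciprocals of primes, bounded below by
   Mertens' first theorem.  Such an n has no prime factor between x^(3/10) and x^(4/10); by Turan's
   second-moment method, windows of L consecutive integers all avoiding those primes have density
   O(1/L).  Since P(n) and P(n+1) always differ, peaks and valleys alternate, so the bound
   for peaks also serves for valleys. *)
theory Submission
  imports Defs "HOL-Analysis.Summation_Tests"
begin

subsection \<open>Mertens' first theorem\<close>

text \<open>Density alone does not produce peaks: the integers with a large prime factor could fill
  a few long blocks, and each block guarantees only one peak. What prevents this is that a typical
  window of L integers has on average at least about L/5 divisors among the primes of the middle
  range, while a window inside a block has none. The bound O(1/L) then falls below the fixed density
  once L is large enough. The exponent 7/10 exceeds 1/2, so that a prime factor above the threshold
  is unique, and 3/10 is what the cofactor has left. The upper ends 9/10 and 4/10 keep the rounding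
  errors o(x): these are estimated by the number of primes in the first range and by the square of
  that number in the second, with every integer counted as a prime.\<close>

definition primes_upto :: "nat \<Rightarrow> nat set" where
  "primes_upto n = {p. prime p \<and> p \<le> n}"

lemma finite_primes_upto [simp]: "finite (primes_upto n)"
  by (rule finite_subset[of _ "{..n}"]) (auto simp: primes_upto_def)

lemma prod_primes_dvd:
  fixes n :: nat
  assumes "finite A" "\<And>p. p \<in> A \<Longrightarrow> prime p" "\<And>p. p \<in> A \<Longrightarrow> p dvd n"
  shows "\<Prod>A dvd n"
  using assms
proof (induction A rule: finite_induct)
  case (insert p A)
  then have "coprime p (\<Prod>A)"
    by (intro prod_coprime_right) (auto intro!: primes_coprime)
  then show ?case using insert by (auto intro!: divides_mult)
qed simp

text \<open>Chebyshev's argument: the primes in the upper half of [1, n] all divide one binomial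
  coefficient, which is at most \<open>2 ^ n\<close>; the lower half is handled by
  induction.\<close>

lemma theta_le: "(\<Sum>p\<in>primes_upto n. ln (real p)) \<le> 3 * ln 2 * real n"
proof (induction n rule: less_induct)
  case (less n)
  consider "n \<le> 1" | "n = 2" | "n \<ge> 3" by linarith
  then show ?case
  proof cases
    case 1
    then have "primes_upto n = {}" by (auto simp: primes_upto_def dest: prime_gt_1_nat)
    then show ?thesis by simp
  next
    case 2
    then have "primes_upto n = {2}"
      by (auto simp: primes_upto_def dest: prime_ge_2_nat)
    then show ?thesis using 2 by simp
  next
    case 3
    \<comment> \<open>Rounding the half up gives \<open>n - h \<le> h\<close>, so a prime above
      \<open>h\<close> divides neither factorial in the denominator. The constant 3 instead of 2
      pays for this rounding: \<open>n + 3 * h \<le> 3 * n\<close> holds from \<open>n = 3\<close>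
      on.\<close>
    define h where "h = (n + 1) div 2"
    have h: "h < n" "h \<le> n" "n - h \<le> h" "2 * h \<le> n + 1" using 3 by (auto simp: h_def)
    define D where "D = primes_upto n - primes_upto h"
    have D: "prime p" "h < p" "p \<le> n" if "p \<in> D" for p
      using that by (auto simp: D_def primes_upto_def)
    have finD: "finite D" by (simp add: D_def)
    have dvd: "p dvd (n choose h)" if "p \<in> D" for p
    proof -
      have "p dvd fact n"
        using D[OF that] by (simp add: prime_dvd_fact_iff)
      then have "p dvd fact h * fact (n - h) * (n choose h)"
        using binomial_fact_lemma[OF h(2)] by simp
      moreover have "\<not> p dvd fact h" "\<not> p dvd fact (n - h)"
        using D[OF that] h by (auto simp: prime_dvd_fact_iff)
      ultimately show ?thesis
        using D(1)[OF that] by (auto simp: prime_dvd_mult_iff)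
    qed
    have "\<Prod>D dvd (n choose h)"
      using finD dvd by (intro prod_primes_dvd) (auto intro: D)
    then have "\<Prod>D \<le> n choose h"
      using h by (intro dvd_imp_le) auto
    also have "\<dots> \<le> 2 ^ n"
    proof -
      have "n choose h \<le> (\<Sum>k\<le>n. n choose k)"
        using h by (intro member_le_sum) auto
      then show ?thesis by (simp add: choose_row_sum)
    qed
    finally have le: "real (\<Prod>D) \<le> 2 ^ n" by (metis of_nat_le_iff of_nat_numeral of_nat_power)
    have pos: "0 < real p" if "p \<in> D" for p using D[OF that] by simp
    have "(\<Sum>p\<in>D. ln (real p)) = ln (real (\<Prod>D))"
      using pos finD by (simp add: ln_prod)
    also have "\<dots> \<le> ln (2 ^ n)"
      using pos finD le by (subst ln_le_cancel_iff) (auto intro!: prod_pos)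
    finally have *: "(\<Sum>p\<in>D. ln (real p)) \<le> real n * ln 2" by (simp add: ln_realpow)
    have "(\<Sum>p\<in>primes_upto n. ln (real p)) = (\<Sum>p\<in>D. ln (real p)) + (\<Sum>p\<in>primes_upto h. ln (real p))"
      unfolding D_def using h
      by (intro sum.subset_diff) (auto simp: primes_upto_def)
    also have "\<dots> \<le> real n * ln 2 + 3 * ln 2 * real h"
      using * less.IH[OF h(1)] by linarith
    also have "\<dots> = ln 2 * (real n + 3 * real h)" by (simp add: algebra_simps)
    also have "\<dots> \<le> ln 2 * (3 * real n)"
    proof (intro mult_left_mono)
      have "2 * real h \<le> real n + 1" using h(4) by linarith
      then show "real n + 3 * real h \<le> 3 * real n" using 3 by linarith
    qed auto
    finally show ?thesis by (simp add: algebra_simps)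
  qed
qed

lemma card_multiples:
  assumes "d > 0"
  shows "card {m\<in>{1..n}. d dvd m} = n div d"
proof -
  have "{m\<in>{1..n}. d dvd m} = (\<lambda>k. d * k) ` {1..n div d}" (is "?A = ?B")
  proof
    show "?A \<subseteq> ?B"
      using assms by (auto elim!: dvdE simp: div_le_mono less_eq_div_iff_mult_less_eq mult.commute intro!: imageI)
    show "?B \<subseteq> ?A"
      using assms by (auto simp: less_eq_div_iff_mult_less_eq mult.commute)
  qed
  moreover have "inj_on (\<lambda>k. d * k) {1..n div d}"
    using assms by (auto intro: inj_onI)
  ultimately show ?thesis by (simp add: card_image)
qed

lemma sum_ln_prime_factors:
  assumes "m > 0"
  shows "ln (real m) = (\<Sum>p\<in>prime_factors m. real (multiplicity p m) * ln (real p))"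
proof -
  have "real m = (\<Prod>p\<in>prime_factors m. real p ^ multiplicity p m)"
    using prime_factorization_nat[OF assms] by (metis (mono_tags, lifting) of_nat_power of_nat_prod prod.cong)
  then have "ln (real m) = (\<Sum>p\<in>prime_factors m. ln (real p ^ multiplicity p m))"
    by (simp add: ln_prod prime_gt_0_nat in_prime_factors_imp_prime)
  also have "\<dots> = (\<Sum>p\<in>prime_factors m. real (multiplicity p m) * ln (real p))"
    by (intro sum.cong refl) (auto simp: ln_realpow prime_gt_0_nat in_prime_factors_imp_prime)
  finally show ?thesis .
qed

lemma ln_fact_sum: "ln (fact n :: real) = (\<Sum>m=1..n. ln (real m))"
  unfolding fact_prod of_nat_prod by (rule ln_prod) auto

lemma ln_fact_le: "ln (fact n :: real) \<le> real n * ln (real n)"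
proof -
  have "(\<Sum>m=1..n. ln (real m)) \<le> (\<Sum>m=1..n. ln (real n))"
    by (intro sum_mono) auto
  then show ?thesis by (simp add: ln_fact_sum)
qed

text \<open>\<open>real n ^ n / fact n\<close> is a single term of the exponential series at
  \<open>n\<close>, hence at most \<open>exp n\<close>.\<close>

lemma ln_fact_ge:
  assumes "n > 0"
  shows "ln (fact n :: real) \<ge> real n * ln (real n) - real n"
proof -
  have "real n ^ n / fact n \<le> exp (real n)"
  proof -
    have "(\<Sum>k\<in>{n}. inverse (fact k) * real n ^ k) \<le> (\<Sum>k. inverse (fact k) * real n ^ k)"
      by (intro sum_le_suminf summable_exp) auto
    then show ?thesis by (simp add: exp_def scaleR_conv_of_real field_simps)
  qed
  then have "ln (real n ^ n / fact n) \<le> real n"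
    using assms by (metis divide_pos_pos fact_gt_zero ln_exp ln_mono of_nat_0_less_iff zero_less_power)
  then show ?thesis using assms by (simp add: ln_div ln_realpow)
qed

lemma of_nat_div_ge: "real n / real d - 1 \<le> real (n div d)"
  using floor_correct[of "real n / real d"] by (simp add: floor_divide_of_nat_eq)

text \<open>One factor \<open>p\<close> for each prime dividing \<open>m\<close> suffices here; rounding \<open>n / p\<close> down costs
  \<open>\<theta>(n)\<close>, which is where the Chebyshev bound enters.\<close>

lemma mertens_upper:
  assumes "n > 0"
  shows "(\<Sum>p\<in>primes_upto n. ln (real p) / real p) \<le> ln (real n) + 3 * ln 2"
proof -
  have "(\<Sum>p\<in>primes_upto n. (real n / real p - 1) * ln (real p))
      \<le> (\<Sum>p\<in>primes_upto n. real (n div p) * ln (real p))"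
  proof (intro sum_mono mult_right_mono)
    fix p assume "p \<in> primes_upto n"
    then have "p > 0" by (auto simp: primes_upto_def prime_gt_0_nat)
    then show "real n / real p - 1 \<le> real (n div p)" "0 \<le> ln (real p)"
      using of_nat_div_ge[of n p] by auto
  qed
  also have "\<dots> = (\<Sum>p\<in>primes_upto n. \<Sum>m=1..n. if p dvd m then ln (real p) else 0)"
  proof (intro sum.cong refl)
    fix p assume "p \<in> primes_upto n"
    then have "p > 0" by (auto simp: primes_upto_def prime_gt_0_nat)
    have "(\<Sum>m=1..n. if p dvd m then ln (real p) else 0) = (\<Sum>m\<in>{m\<in>{1..n}. p dvd m}. ln (real p))"
      by (intro sum.inter_filter[symmetric]) auto
    then show "real (n div p) * ln (real p) = (\<Sum>m=1..n. if p dvd m then ln (real p) else 0)"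
      using card_multiples[OF \<open>p > 0\<close>, of n] by simp
  qed
  also have "\<dots> = (\<Sum>m=1..n. \<Sum>p\<in>primes_upto n. if p dvd m then ln (real p) else 0)"
    by (rule sum.swap)
  also have "\<dots> \<le> (\<Sum>m=1..n. ln (real m))"
  proof (intro sum_mono)
    fix m assume m: "m \<in> {1..n}"
    have "(\<Sum>p\<in>primes_upto n. if p dvd m then ln (real p) else 0)
        = (\<Sum>p\<in>{p\<in>primes_upto n. p dvd m}. ln (real p))"
      by (simp add: sum.inter_filter)
    also have "{p\<in>primes_upto n. p dvd m} = prime_factors m"
      using m by (auto simp: primes_upto_def in_prime_factors_iff intro: order.trans[OF dvd_imp_le])
    also have "(\<Sum>p\<in>prime_factors m. ln (real p))
        \<le> (\<Sum>p\<in>prime_factors m. real (multiplicity p m) * ln (real p))"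
    proof (intro sum_mono)
      fix p assume p: "p \<in> prime_factors m"
      then have "multiplicity p m \<ge> 1"
        by (simp add: prime_factors_multiplicity)
      moreover have "ln (real p) \<ge> 0" using p by (auto simp: prime_gt_0_nat Suc_leI in_prime_factors_imp_prime)
      ultimately show "ln (real p) \<le> real (multiplicity p m) * ln (real p)"
        using mult_right_mono[of 1 "real (multiplicity p m)" "ln (real p)"] by simp
    qed
    finally show "(\<Sum>p\<in>primes_upto n. if p dvd m then ln (real p) else 0) \<le> ln (real m)"
      using m sum_ln_prime_factors[of m] by simp
  qed
  also have "\<dots> \<le> real n * ln (real n)" using ln_fact_le ln_fact_sum by metis
  finally have "real n * (\<Sum>p\<in>primes_upto n. ln (real p) / real p) - (\<Sum>p\<in>primes_upto n. ln (real p))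
      \<le> real n * ln (real n)"
    by (simp add: algebra_simps sum_subtractf sum_distrib_left)
  then have "real n * (\<Sum>p\<in>primes_upto n. ln (real p) / real p) \<le> real n * (ln (real n) + 3 * ln 2)"
    using theta_le[of n] by (simp add: algebra_simps)
  then show ?thesis using assms by simp
qed

text \<open>Since 1/(p-1) = 1/p + 1/(p(p-1)), this series controls what the higher powers of the
  primes contribute in \<open>mertens_lower\<close>. The bound ln m \<le> 2 sqrt m makes it
  comparable to the sum of m^(-3/2).\<close>

lemma summable_ln_over_square: "summable (\<lambda>m. ln (real m) / (real m * (real m - 1)))"
proof (rule summable_comparison_test_ev)
  show "summable (\<lambda>m. 4 * real m powr (- 3 / 2))"
    by (intro summable_mult) (simp add: summable_real_powr_iff)
  show "\<forall>\<^sub>F m in sequentially. norm (ln (real m) / (real m * (real m - 1))) \<le> 4 * real m powr (- 3 / 2)"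
    using eventually_ge_at_top[of 2]
  proof eventually_elim
    case (elim m)
    have "ln (real m) \<le> 2 * sqrt (real m)"
    proof -
      have "ln (sqrt (real m)) \<le> sqrt (real m)" using elim by (simp add: ln_bound)
      then show ?thesis using elim by (simp add: ln_sqrt)
    qed
    moreover have "real m * (real m - 1) \<ge> real m ^ 2 / 2"
      using elim mult_left_mono[of "real m / 2" "real m - 1" "real m"] by (simp add: power2_eq_square)
    ultimately have "ln (real m) / (real m * (real m - 1)) \<le> 2 * sqrt (real m) / (real m ^ 2 / 2)"
      using elim by (intro frac_le) auto
    also have "\<dots> = 4 * (real m powr (1/2) / real m powr 2)"
      using elim by (simp add: powr_half_sqrt)
    also have "\<dots> = 4 * real m powr (- 3 / 2)"
      unfolding powr_diff[symmetric] by simp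
    finally show ?case using elim by simp
  qed
qed

text \<open>The left side is the exponent of \<open>p\<close> in n!. Legendre's formula with the
  floors dropped is a geometric series.\<close>

lemma sum_multiplicity_le:
  assumes "prime p"
  shows "(\<Sum>m=1..n. real (multiplicity p m)) \<le> real n / (real p - 1)"
proof -
  have p: "p \<ge> 2" using assms by (rule prime_ge_2_nat)
  have mult: "multiplicity p m = card {k\<in>{1..n}. p ^ k dvd m}" if m: "m \<in> {1..n}" for m
  proof -
    have "multiplicity p m \<le> n"
    proof -
      have "multiplicity p m < p ^ multiplicity p m" using p by (intro power_gt_expt) auto
      also have "\<dots> \<le> m" using m by (intro dvd_imp_le multiplicity_dvd) auto
      finally show ?thesis using m by simp
    qed
    then have "{k\<in>{1..n}. p ^ k dvd m} = {1..multiplicity p m}"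
      using m p by (auto simp: power_dvd_iff_le_multiplicity intro: le_trans)
    then show ?thesis by simp
  qed
  have "(\<Sum>m=1..n. real (multiplicity p m)) = (\<Sum>m=1..n. \<Sum>k=1..n. if p ^ k dvd m then 1 else 0)"
    using mult by (intro sum.cong refl) (simp flip: sum.inter_filter)
  also have "\<dots> = (\<Sum>k=1..n. \<Sum>m=1..n. if p ^ k dvd m then 1 else 0)" by (rule sum.swap)
  also have "\<dots> = (\<Sum>k=1..n. real (n div p ^ k))"
    using p card_multiples[of "p ^ _" n] by (intro sum.cong refl) (simp flip: sum.inter_filter)
  also have "\<dots> \<le> (\<Sum>k=1..n. real n * (1 / real p) ^ k)"
    using of_nat_div_le_of_nat[of n "p ^ _", where ?'a = real] by (intro sum_mono) (simp add: power_divide)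
  also have "\<dots> = real n * (\<Sum>k=1..n. (1 / real p) ^ k)" by (simp add: sum_distrib_left)
  also have "(\<Sum>k=1..n. (1 / real p) ^ k) \<le> 1 / (real p - 1)"
  proof -
    have "(\<Sum>k=1..n. (1 / real p) ^ k) = (1 / real p) * (\<Sum>k<n. (1 / real p) ^ k)"
      by (simp add: sum_distrib_left sum.atLeast1_atMost_eq)
    also have "\<dots> \<le> (1 / real p) * (1 / (1 - 1 / real p))"
      using p by (intro mult_left_mono) (auto simp: sum_gp_strict divide_right_mono)
    also have "\<dots> = 1 / (real p - 1)" using p by (simp add: field_simps)
    finally show ?thesis .
  qed
  finally show ?thesis by (simp add: mult_left_mono)
qed

text \<open>The lower bound for ln n! has to be matched by its complete factorization, so here all
  powers of \<open>p\<close> are counted; rounding down now works in the right direction.\<close>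

lemma mertens_lower:
  obtains C :: real where
    "\<And>n. n > 0 \<Longrightarrow> (\<Sum>p\<in>primes_upto n. ln (real p) / real p) \<ge> ln (real n) - C"
proof
  define S where "S = (\<Sum>m. ln (real m) / (real m * (real m - 1)))"
  fix n :: nat assume n: "n > 0"
  have "real n * ln (real n) - real n \<le> (\<Sum>m=1..n. ln (real m))"
    using ln_fact_ge[OF n] by (simp add: ln_fact_sum)
  also have "\<dots> = (\<Sum>m=1..n. \<Sum>p\<in>primes_upto n. real (multiplicity p m) * ln (real p))"
  proof (intro sum.cong refl)
    fix m assume m: "m \<in> {1..n}"
    then have "(\<Sum>p\<in>prime_factors m. real (multiplicity p m) * ln (real p))
        = (\<Sum>p\<in>primes_upto n. real (multiplicity p m) * ln (real p))"
      by (intro sum.mono_neutral_left)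
         (auto simp: primes_upto_def in_prime_factors_iff not_dvd_imp_multiplicity_0 dest!: dvd_imp_le)
    then show "ln (real m) = (\<Sum>p\<in>primes_upto n. real (multiplicity p m) * ln (real p))"
      using sum_ln_prime_factors[of m] m by simp
  qed
  also have "\<dots> = (\<Sum>p\<in>primes_upto n. (\<Sum>m=1..n. real (multiplicity p m)) * ln (real p))"
    by (subst sum.swap) (simp add: sum_distrib_right)
  also have "\<dots> \<le> (\<Sum>p\<in>primes_upto n. real n / (real p - 1) * ln (real p))"
    by (intro sum_mono mult_right_mono sum_multiplicity_le)
       (auto simp: primes_upto_def Suc_le_eq prime_gt_0_nat)
  also have "\<dots> = real n * ((\<Sum>p\<in>primes_upto n. ln (real p) / real p)
      + (\<Sum>p\<in>primes_upto n. ln (real p) / (real p * (real p - 1))))"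
  proof -
    have "real n / (real p - 1) * ln (real p)
        = real n * (ln (real p) / real p + ln (real p) / (real p * (real p - 1)))"
      if "p \<in> primes_upto n" for p
    proof -
      have "real p > 1" using that by (auto simp: primes_upto_def dest: prime_gt_1_nat)
      then show ?thesis by (simp add: divide_simps) (simp add: algebra_simps)
    qed
    then show ?thesis by (simp add: sum_distrib_left sum.distrib distrib_left)
  qed
  finally have "ln (real n) - 1 \<le> (\<Sum>p\<in>primes_upto n. ln (real p) / real p)
      + (\<Sum>p\<in>primes_upto n. ln (real p) / (real p * (real p - 1)))"
    using n by (simp add: right_diff_distrib[of "real n" "ln (real n)" 1, simplified, symmetric])
  moreover have "(\<Sum>p\<in>primes_upto n. ln (real p) / (real p * (real p - 1))) \<le> S"
    unfolding S_def
  proof (intro sum_le_suminf summable_ln_over_square ballI finite_primes_upto)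
    fix m :: nat
    \<comment> \<open>At \<open>m = 0\<close> the factor \<open>real m - 1\<close> is negative, but
      the denominator is 0 and so is the quotient.\<close>
    show "0 \<le> ln (real m) / (real m * (real m - 1))" by (cases "m = 0") auto
  qed
  ultimately show "(\<Sum>p\<in>primes_upto n. ln (real p) / real p) \<ge> ln (real n) - (1 + S)"
    by linarith
qed

section \<open>Reciprocal sums over primes in an interval\<close>

definition primes_between :: "real \<Rightarrow> real \<Rightarrow> nat set" where
  "primes_between u v = {p. prime p \<and> u < real p \<and> real p \<le> v}"

lemma primes_between_subset: "primes_between u v \<subseteq> {1..nat \<lfloor>v\<rfloor>}"
  by (auto simp: primes_between_def le_nat_floor Suc_le_eq prime_gt_0_nat)

lemma finite_primes_between [simp]: "finite (primes_between u v)"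
  using primes_between_subset finite_subset by blast

lemma card_primes_between_le:
  assumes "v \<ge> 0"
  shows "real (card (primes_between u v)) \<le> v"
proof -
  have "card (primes_between u v) \<le> card {1..nat \<lfloor>v\<rfloor>}"
    by (intro card_mono primes_between_subset) auto
  then have "real (card (primes_between u v)) \<le> real (nat \<lfloor>v\<rfloor>)" by simp
  then show ?thesis using assms by linarith
qed

lemma ln_nat_floor_bounds:
  assumes "z \<ge> 1"
  shows "ln (real (nat \<lfloor>z\<rfloor>)) \<le> ln z" "ln z - ln 2 \<le> ln (real (nat \<lfloor>z\<rfloor>))"
proof -
  have ge1: "1 \<le> real (nat \<lfloor>z\<rfloor>)" using le_nat_floor[of 1 z] assms by simp
  then show "ln (real (nat \<lfloor>z\<rfloor>)) \<le> ln z" using assms by (subst ln_le_cancel_iff) linarith+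
  have "z \<le> 2 * real (nat \<lfloor>z\<rfloor>)" using assms ge1 by linarith
  then have "ln z \<le> ln (2 * real (nat \<lfloor>z\<rfloor>))" using assms by (intro ln_mono) linarith+
  moreover have "ln (2 * w) = ln 2 + ln w" if "w \<ge> 1" for w :: real using that by (simp add: ln_mult)
  ultimately show "ln z - ln 2 \<le> ln (real (nat \<lfloor>z\<rfloor>))" using ge1 by fastforce
qed

text \<open>Subtracting the two Mertens bounds leaves an error uniform in \<open>u\<close> and
  \<open>v\<close>, and ln p \<le> ln v turns the weights ln p / p into 1/p. This loses a constant
  factor but stays positive when \<open>v\<close> is a fixed power of \<open>u\<close> with exponent
  above 1 and \<open>u\<close> is large.\<close>

lemma sum_inverse_primes_between_ge:
  obtains C :: real where "\<And>u v. 1 \<le> u \<Longrightarrow> u \<le> v \<Longrightarrow>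
    (\<Sum>p\<in>primes_between u v. 1 / real p) * ln v \<ge> ln v - ln u - C"
proof -
  obtain C where C: "\<And>n. n > 0 \<Longrightarrow> (\<Sum>p\<in>primes_upto n. ln (real p) / real p) \<ge> ln (real n) - C"
    using mertens_lower by blast
  \<comment> \<open>Of the \<open>4 * ln 2\<close>, three come from \<open>mertens_upper\<close> at
    \<open>u\<close> and one from rounding \<open>v\<close> down.\<close>
  have "(\<Sum>p\<in>primes_between u v. 1 / real p) * ln v \<ge> ln v - ln u - (C + 4 * ln 2)"
    if uv: "1 \<le> u" "u \<le> v" for u v :: real
  proof -
    let ?m = "nat \<lfloor>u\<rfloor>" and ?n = "nat \<lfloor>v\<rfloor>"
    have mn: "?m > 0" "?n > 0" "?m \<le> ?n" using uv by (auto intro: nat_mono floor_mono)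
    have eq: "primes_between u v = primes_upto ?n - primes_upto ?m"
      using uv by (auto simp: primes_between_def primes_upto_def le_nat_iff le_floor_iff not_le)
    have "ln v - ln 2 - C - (ln u + 3 * ln 2)
        \<le> (\<Sum>p\<in>primes_upto ?n. ln (real p) / real p) - (\<Sum>p\<in>primes_upto ?m. ln (real p) / real p)"
      using C[OF mn(2)] mertens_upper[OF mn(1)] ln_nat_floor_bounds(1)[of u]
        ln_nat_floor_bounds(2)[of v] uv by linarith
    also have "\<dots> = (\<Sum>p\<in>primes_between u v. ln (real p) / real p)"
      unfolding eq using mn by (intro sum_diff[symmetric]) (auto simp: primes_upto_def)
    also have "\<dots> \<le> (\<Sum>p\<in>primes_between u v. 1 / real p * ln v)"
    proof (intro sum_mono)
      fix p assume "p \<in> primes_between u v"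
      then have "ln (real p) \<le> ln v"
        by (intro ln_mono) (auto simp: primes_between_def prime_gt_0_nat)
      then show "ln (real p) / real p \<le> 1 / real p * ln v" by (simp add: divide_right_mono)
    qed
    finally show ?thesis by (simp add: sum_distrib_right)
  qed
  then show ?thesis using that by blast
qed

text \<open>For u = y^a and v = y^b the main term (ln v - ln u) / ln v is exactly 1 - a/b, and the
  error C / ln v tends to 0.\<close>

lemma eventually_sum_inverse_primes_between_powers_ge:
  fixes a b :: nat and c :: real
  assumes "a < b" "c < 1 - real a / real b"
  shows "\<forall>\<^sub>F y in at_top. (\<Sum>p\<in>primes_between (y ^ a) (y ^ b). 1 / real p) \<ge> c"
proof -
  obtain C where C: "\<And>u v. 1 \<le> u \<Longrightarrow> u \<le> v \<Longrightarrow>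
    (\<Sum>p\<in>primes_between u v. 1 / real p) * ln v \<ge> ln v - ln u - C"
    using sum_inverse_primes_between_ge by blast
  \<comment> \<open>\<open>d\<close> is \<open>b\<close> times the slack in the hypothesis on
    \<open>c\<close>; once \<open>d * ln y\<close> exceeds \<open>C\<close> the error is
    absorbed.\<close>
  define d where "d = real b - real a - c * real b"
  have "d > 0" using assms by (simp add: d_def field_simps)
  have "\<forall>\<^sub>F y :: real in at_top. C / d \<le> ln y"
    using ln_at_top by (auto simp: filterlim_at_top)
  then show ?thesis using eventually_gt_at_top[of 1]
  proof eventually_elim
    case (elim y)
    have "ln y > 0" using elim by simp
    have "C \<le> d * ln y" using elim \<open>d > 0\<close> by (simp add: field_simps)
    moreover have "(\<Sum>p\<in>primes_between (y ^ a) (y ^ b). 1 / real p) * (real b * ln y)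
        \<ge> real b * ln y - real a * ln y - C"
      using C[of "y ^ a" "y ^ b"] elim assms by (simp add: ln_realpow)
    ultimately have "c * (real b * ln y) \<le> (\<Sum>p\<in>primes_between (y ^ a) (y ^ b). 1 / real p) * (real b * ln y)"
      by (simp add: d_def algebra_simps)
    then show ?case using \<open>ln y > 0\<close> assms by simp
  qed
qed

subsection \<open>Windows without prime factors from a given set\<close>

text \<open>Two distinct elements differ by at least \<open>d\<close>, so \<open>n div d\<close>
  separates them. Pairwise congruence, in place of a named residue class, also covers simultaneous
  conditions modulo two primes without computing the common residue.\<close>

lemma card_congruent_le:
  fixes d N :: nat
  assumes d: "d > 0" and A: "A \<subseteq> {1..N}"
    and cong: "\<And>m n. m \<in> A \<Longrightarrow> n \<in> A \<Longrightarrow> m \<le> n \<Longrightarrow> d dvd n - m"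
  shows "real (card A) \<le> real N / real d + 1"
proof -
  have "finite A" using A finite_subset by blast
  have "inj_on (\<lambda>n. n div d) A"
  proof (rule linorder_inj_onI')
    fix m n assume mn: "m \<in> A" "n \<in> A" "m < n"
    obtain k where k: "n = m + d * k"
      using cong[OF mn(1,2)] mn(3) by (metis dvdE le_add_diff_inverse less_imp_le)
    with mn(3) d show "m div d \<noteq> n div d" by auto
  qed
  then have "card A \<le> card {0..N div d}"
    using A by (intro card_inj_on_le[of "\<lambda>n. n div d"]) (auto simp: div_le_mono)
  then have "real (card A) \<le> real (N div d) + 1" by simp
  then show ?thesis using of_nat_div_le_of_nat[of N d, where ?'a = real] by linarith
qed

lemma card_shifted_multiples_ge:
  fixes d N i :: nat
  assumes "d > 0"
  shows "real (card {n\<in>{1..N}. d dvd n + i}) \<ge> real N / real d - 1"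
proof -
  let ?A = "{n\<in>{1..N}. d dvd n + i}"
  have bounds: "i < d * k" "d * k \<le> N + i" if "k \<in> {i div d<..(N + i) div d}" for k
  proof -
    have "i div d < k" "k \<le> (N + i) div d" using that by auto
    then show "i < d * k" "d * k \<le> N + i"
      using assms by (simp_all only: div_less_iff_less_mult less_eq_div_iff_mult_less_eq mult.commute)
  qed
  have "inj_on (\<lambda>k. d * k - i) {i div d<..(N + i) div d}"
  proof (rule linorder_inj_onI')
    fix k l assume kl: "k \<in> {i div d<..(N + i) div d}" "k < l"
    then have "d * k < d * l" using assms by simp
    with bounds(1)[OF kl(1)] show "d * k - i \<noteq> d * l - i" by linarith
  qed
  moreover have "(\<lambda>k. d * k - i) ` {i div d<..(N + i) div d} \<subseteq> ?A"
  proof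
    fix n assume "n \<in> (\<lambda>k. d * k - i) ` {i div d<..(N + i) div d}"
    then obtain k where k: "k \<in> {i div d<..(N + i) div d}" "n = d * k - i" by blast
    then have "n + i = d * k" using bounds(1)[OF k(1)] by linarith
    then show "n \<in> ?A" using bounds[OF k(1)] k(2) by auto
  qed
  ultimately have "card {i div d<..(N + i) div d} \<le> card ?A"
    by (intro card_inj_on_le[of "\<lambda>k. d * k - i"]) auto
  moreover have "real ((N + i) div d) \<ge> real (N + i) / real d - 1"
    using floor_correct[of "real (N + i) / real d"] by (simp only: floor_divide_of_nat_eq) simp
  moreover have "real (i div d) \<le> real i / real d" by (rule of_nat_div_le_of_nat)
  ultimately show ?thesis by (simp add: add_divide_distrib)
qed

text \<open>Turan's second-moment method: the number of pairs \<open>(i, p)\<close> with \<open>p\<close> dividing \<open>n + i\<close> has mean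
  \<open>\<Lambda>\<close> over \<open>n \<le> N\<close> and, since distinct shifts cannot share a \<open>p \<ge> L\<close>, variance about \<open>\<Lambda>\<close>.\<close>

lemma card_no_prime_factor_in_window_le:
  fixes Q :: "nat set" and N L :: nat
  defines "\<Lambda> \<equiv> real L * (\<Sum>p\<in>Q. 1 / real p)"
  assumes fin: "finite Q" and prime: "\<And>p. p \<in> Q \<Longrightarrow> prime p" and large: "\<And>p. p \<in> Q \<Longrightarrow> L \<le> p"
    and pos: "\<Lambda> > 0"
  shows "real (card {n\<in>{1..N}. \<forall>i<L. \<forall>p\<in>Q. \<not> p dvd n + i})
    \<le> real N / \<Lambda> + 4 * (real L * real (card Q) / \<Lambda>)\<^sup>2"
proof -
  define I where "I = {..<L} \<times> Q"
  define f :: "nat \<Rightarrow> nat \<times> nat \<Rightarrow> real" where "f = (\<lambda>n (i, p). if p dvd n + i then 1 else 0)"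
  define S where "S = (\<lambda>n. \<Sum>u\<in>I. f n u)"
  define K where "K = real L * real (card Q)"
  let ?B = "{n\<in>{1..N}. \<forall>i<L. \<forall>p\<in>Q. \<not> p dvd n + i}"
  have finI: "finite I" using fin by (simp add: I_def)
  have cardI: "real (card I) = K" by (simp add: I_def K_def card_cartesian_product)
  have ppos: "p > 0" if "p \<in> Q" for p using prime[OF that] prime_gt_0_nat by blast
  have sumI: "(\<Sum>u\<in>I. 1 / real (snd u)) = \<Lambda>"
  proof -
    have "(\<Sum>u\<in>I. 1 / real (snd u)) = (\<Sum>i<L. \<Sum>p\<in>Q. 1 / real p)"
      unfolding I_def sum.cartesian_product by (simp add: split_beta)
    then show ?thesis by (simp add: \<Lambda>_def)
  qed
  have sum_f: "(\<Sum>n=1..N. f n (i, p)) = real (card {n\<in>{1..N}. p dvd n + i})" for i p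
    by (simp add: f_def flip: sum.inter_filter)
  have sum_ff: "(\<Sum>n=1..N. f n (i, p) * f n (j, q)) = real (card {n\<in>{1..N}. p dvd n + i \<and> q dvd n + j})"
    for i j p q
  proof -
    have "(\<Sum>n=1..N. f n (i, p) * f n (j, q)) = (\<Sum>n=1..N. if p dvd n + i \<and> q dvd n + j then 1 else 0)"
      by (intro sum.cong) (auto simp: f_def)
    then show ?thesis by (simp flip: sum.inter_filter)
  qed
  have dvd_diff: "p dvd n - m" if "p dvd m + i" "p dvd n + i" for p m n i :: nat
    using dvd_diff_nat[OF that(2,1)] by simp
  have S1: "(\<Sum>n=1..N. S n) \<ge> real N * \<Lambda> - K"
  proof -
    have "(\<Sum>n=1..N. S n) = (\<Sum>u\<in>I. \<Sum>n=1..N. f n u)"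
      unfolding S_def by (rule sum.swap)
    also have "\<dots> \<ge> (\<Sum>u\<in>I. real N * (1 / real (snd u)) - 1)"
    proof (intro sum_mono)
      fix u assume "u \<in> I"
      then obtain i p where u: "u = (i, p)" "p \<in> Q" by (auto simp: I_def)
      show "real N * (1 / real (snd u)) - 1 \<le> (\<Sum>n=1..N. f n u)"
        unfolding u sum_f using card_shifted_multiples_ge[OF ppos[OF u(2)]] by simp
    qed
    also have "(\<Sum>u\<in>I. real N * (1 / real (snd u)) - 1) = real N * \<Lambda> - K"
      by (simp only: sum_subtractf sum_distrib_left[symmetric] sumI) (simp add: cardI)
    finally show ?thesis .
  qed
  \<comment> \<open>\<open>K\<close> is a natural number, so the linear error from the diagonal
    pairs is absorbed into the quadratic one.\<close>
  have "K \<le> K * K"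
  proof -
    have "K = real (L * card Q)" by (simp add: K_def)
    then show ?thesis by (metis of_nat_mult of_nat_le_iff le_square)
  qed
  have S2: "(\<Sum>n=1..N. (S n)\<^sup>2) \<le> real N * \<Lambda>\<^sup>2 + real N * \<Lambda> + 2 * K\<^sup>2"
  proof -
    \<comment> \<open>The first summand is the value expected from independence plus a rounding
      error; the diagonal \<open>u = v\<close>, where \<open>f\<close> is squared, pays the
      second.\<close>
    have pair: "(\<Sum>n=1..N. f n u * f n v)
        \<le> (real N * (1 / real (snd u)) * (1 / real (snd v)) + 1)
          + (if u = v then real N * (1 / real (snd u)) + 1 else 0)"
      if uv: "u \<in> I" "v \<in> I" for u v
    proof -
      obtain i p j q where eq: "u = (i, p)" "v = (j, q)" by (metis surj_pair)
      have ij: "i < L" "j < L" "p \<in> Q" "q \<in> Q" using uv by (auto simp: I_def eq)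
      let ?A = "{n\<in>{1..N}. p dvd n + i \<and> q dvd n + j}"
      consider "u = v" | "p = q" "i \<noteq> j" | "p \<noteq> q" using eq by auto
      then show ?thesis
      proof cases
        case 1
        have "real (card ?A) \<le> real N / real p + 1"
          using ppos[OF ij(3)] by (intro card_congruent_le) (auto intro: dvd_diff)
        then have "(\<Sum>n=1..N. f n u * f n v) \<le> real N * (1 / real (snd u)) + 1"
          unfolding eq sum_ff by simp
        moreover have "0 \<le> real N * (1 / real (snd u)) * (1 / real (snd v))" by simp
        ultimately show ?thesis unfolding if_P[OF 1] by linarith
      next
        case 2
        have False if "n \<in> ?A" for n
        proof -
          \<comment> \<open>Subtraction of naturals truncates, so both orders are recorded: one of
            them is the nonzero difference of the shifts, which is smaller than
            \<open>L \<le> p\<close>.\<close>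
          have "p dvd (n + i) - (n + j)" "p dvd (n + j) - (n + i)"
            using that 2 dvd_diff_nat[of p "n + i" "n + j"] dvd_diff_nat[of p "n + j" "n + i"] by blast+
          then have "p dvd i - j" "p dvd j - i" by auto
          then show False using ij(1,2) large[OF ij(3)] 2
            by (cases "i < j") (auto dest!: dvd_imp_le)
        qed
        then have "?A = {}" by blast
        then show ?thesis unfolding eq sum_ff by (simp only: card.empty) simp
      next
        case 3
        have "coprime p q" using 3 ij prime primes_coprime by blast
        then have "real (card ?A) \<le> real N / real (p * q) + 1"
          using ppos ij by (intro card_congruent_le) (auto intro!: divides_mult intro: dvd_diff)
        then show ?thesis using 3 unfolding eq sum_ff by simp
      qed
    qed
    have "(\<Sum>n=1..N. (S n)\<^sup>2) = (\<Sum>n=1..N. \<Sum>u\<in>I. \<Sum>v\<in>I. f n u * f n v)"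
      by (simp add: S_def power2_eq_square sum_product)
    also have "\<dots> = (\<Sum>u\<in>I. \<Sum>v\<in>I. \<Sum>n=1..N. f n u * f n v)"
      by (subst sum.swap, intro sum.cong refl, rule sum.swap)
    also have "\<dots> \<le> (\<Sum>u\<in>I. \<Sum>v\<in>I. (real N * (1 / real (snd u)) * (1 / real (snd v)) + 1)
          + (if u = v then real N * (1 / real (snd u)) + 1 else 0))"
      by (intro sum_mono pair)
    also have "\<dots> = (\<Sum>u\<in>I. real N * (1 / real (snd u)) * \<Lambda> + K + real N * (1 / real (snd u)) + 1)"
      using finI by (intro sum.cong refl)
        (simp only: sum.distrib sum_distrib_left[symmetric] sumI, simp add: cardI)
    also have "\<dots> = real N * \<Lambda> * \<Lambda> + K * K + real N * \<Lambda> + K"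
      by (simp only: sum.distrib sum_distrib_left[symmetric] sum_distrib_right[symmetric] sumI)
        (simp add: cardI)
    also have "\<dots> \<le> real N * \<Lambda>\<^sup>2 + real N * \<Lambda> + 2 * K\<^sup>2"
      using \<open>K \<le> K * K\<close> by (simp add: power2_eq_square)
    finally show ?thesis .
  qed
  \<comment> \<open>This bounds the mixed term 2 \<Lambda> K by 2 K^2, whence the factor 4 in the
    result.\<close>
  have "\<Lambda> \<le> K"
  proof -
    have "(\<Sum>p\<in>Q. 1 / real p) \<le> (\<Sum>p\<in>Q. 1)"
      using ppos by (intro sum_mono) (auto simp: Suc_le_eq)
    then show ?thesis by (simp add: \<Lambda>_def K_def mult_left_mono)
  qed
  \<comment> \<open>Chebyshev's inequality: \<open>S n\<close> vanishes on \<open>?B\<close>, so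
    each such \<open>n\<close> contributes the full \<open>\<Lambda>\<^sup>2\<close> to the sum of
    squared deviations.\<close>
  have "real (card ?B) * \<Lambda>\<^sup>2 = (\<Sum>n\<in>?B. (\<Lambda> - S n)\<^sup>2)"
  proof -
    have "S n = 0" if "n \<in> ?B" for n
      using that unfolding S_def by (intro sum.neutral) (auto simp: f_def I_def)
    then show ?thesis by simp
  qed
  also have "\<dots> \<le> (\<Sum>n=1..N. (\<Lambda> - S n)\<^sup>2)"
    by (intro sum_mono2) auto
  also have "\<dots> = real N * \<Lambda>\<^sup>2 - 2 * \<Lambda> * (\<Sum>n=1..N. S n) + (\<Sum>n=1..N. (S n)\<^sup>2)"
    by (simp add: power2_diff sum.distrib sum_subtractf sum_distrib_left)
  also have "\<dots> \<le> real N * \<Lambda>\<^sup>2 - 2 * \<Lambda> * (real N * \<Lambda> - K) + (real N * \<Lambda>\<^sup>2 + real N * \<Lambda> + 2 * K\<^sup>2)"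
    using S1 S2 pos by (intro add_mono diff_mono mult_left_mono) auto
  also have "\<dots> = real N * \<Lambda> + 2 * \<Lambda> * K + 2 * K\<^sup>2"
    by (simp add: algebra_simps power2_eq_square)
  also have "\<dots> \<le> real N * \<Lambda> + 4 * K\<^sup>2"
    using \<open>\<Lambda> \<le> K\<close> pos mult_right_mono[of \<Lambda> K K] by (simp add: power2_eq_square)
  finally have "real (card ?B) \<le> (real N * \<Lambda> + 4 * K\<^sup>2) / \<Lambda>\<^sup>2"
    using pos by (simp add: pos_le_divide_eq)
  also have "\<dots> = real N / \<Lambda> + 4 * (K / \<Lambda>)\<^sup>2"
    using pos by (simp add: field_simps power2_eq_square)
  finally show ?thesis by (simp add: K_def)
qed

subsection \<open>Peaks, valleys and blocks\<close>

lemma largest_prime_factor_prime_dvd: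
  assumes "n \<ge> 2"
  shows "prime (largest_prime_factor n)" "largest_prime_factor n dvd n"
proof -
  have "prime_factors n \<noteq> {}"
    using assms by (simp add: prime_factorization_empty_iff)
  then have "Max (prime_factors n) \<in> prime_factors n" by (intro Max_in) auto
  then show "prime (largest_prime_factor n)" "largest_prime_factor n dvd n"
    using assms by (auto simp: largest_prime_factor_def)
qed

lemma prime_le_largest_prime_factor:
  assumes "prime p" "p dvd n" "n > 0"
  shows "p \<le> largest_prime_factor n"
  using assms by (auto simp: largest_prime_factor_def in_prime_factors_iff intro!: Max_ge)

lemma largest_prime_factor_1 [simp]: "largest_prime_factor (Suc 0) = 1"
  by (simp add: largest_prime_factor_def)

text \<open>A common value would be a prime dividing two consecutive integers; at
  \<open>n = 1\<close> the conventional value 1 is not prime.\<close>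

lemma largest_prime_factor_Suc_neq:
  assumes "n \<ge> 1"
  shows "largest_prime_factor n \<noteq> largest_prime_factor (Suc n)"
proof
  assume eq: "largest_prime_factor n = largest_prime_factor (Suc n)"
  let ?p = "largest_prime_factor (Suc n)"
  have p: "prime ?p" "?p dvd Suc n" using assms largest_prime_factor_prime_dvd[of "Suc n"] by auto
  then have "n \<ge> 2" using assms eq by (cases "n = 1") auto
  then have "?p dvd n" using largest_prime_factor_prime_dvd(2)[of n] eq by simp
  with p(2) have "?p dvd Suc n - n" by (intro dvd_diff_nat) auto
  then show False using p by auto
qed

lemma largest_prime_factor_prime:
  assumes "prime p"
  shows "largest_prime_factor p = p"
proof -
  have "p \<noteq> 1" using assms by auto
  then show ?thesis using assms by (simp add: largest_prime_factor_def prime_prime_factors)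
qed

lemma largest_prime_factor_2_3_4:
  "largest_prime_factor 2 = 2" "largest_prime_factor 3 = 3" "largest_prime_factor 4 = 2"
proof -
  show "largest_prime_factor 2 = 2" "largest_prime_factor 3 = 3"
    by (simp_all add: largest_prime_factor_prime)
  have "prime (largest_prime_factor 4)" "largest_prime_factor 4 dvd 2 ^ 2"
    using largest_prime_factor_prime_dvd[of 4] by auto
  then show "largest_prime_factor 4 = 2"
    using prime_dvd_power[of "largest_prime_factor 4" 2 2] by (simp add: primes_dvd_imp_eq)
qed

text \<open>Going left from \<open>m\<close> against the descent, the first \<open>k\<close>
  preceded by an ascent is a peak; the walk stops before 1 because the value at 1 is below the value
  at 2. The comparison with the value at \<open>m\<close> keeps the whole stretch above any
  threshold that \<open>m\<close> exceeds.\<close>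

lemma descent_to_peak:
  assumes "1 \<le> m" "largest_prime_factor (Suc m) < largest_prime_factor m"
  shows "\<exists>k\<ge>2. k \<le> m \<and> largest_prime_factor (k - 1) < largest_prime_factor k \<and>
    (\<forall>j\<in>{k..m}. largest_prime_factor (Suc j) < largest_prime_factor j \<and>
      largest_prime_factor m \<le> largest_prime_factor j)"
  using assms
proof (induction m rule: nat_induct_at_least)
  case base
  then show ?case using largest_prime_factor_2_3_4 by (simp add: numeral_2_eq_2)
next
  case (Suc m)
  consider "largest_prime_factor m < largest_prime_factor (Suc m)"
    | "largest_prime_factor (Suc m) < largest_prime_factor m"
    using largest_prime_factor_Suc_neq[OF Suc.hyps] by linarith
  then show ?case
  proof cases
    case 1
    then show ?thesis using Suc by (intro exI[of _ "Suc m"]) auto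
  next
    case 2
    then obtain k where "2 \<le> k" "k \<le> m" "largest_prime_factor (k - 1) < largest_prime_factor k"
      "\<forall>j\<in>{k..m}. largest_prime_factor (Suc j) < largest_prime_factor j \<and>
      largest_prime_factor m \<le> largest_prime_factor j"
      using Suc.IH by blast
    moreover have "largest_prime_factor (Suc m) \<le> largest_prime_factor j" if "j \<in> {k..m}" for j
      using 2 calculation(4) that by (meson less_imp_le less_le_trans)
    ultimately show ?thesis using 2 Suc.prems
      by (intro exI[of _ k]) (auto simp: le_Suc_eq)
  qed
qed

text \<open>The start at 4 is a valley (\<open>3 > 2 < 5\<close>), so the descent cannot run past it.\<close>

lemma descent_to_valley:
  assumes "4 \<le> m" "largest_prime_factor m < largest_prime_factor (Suc m)"
  shows "\<exists>k\<ge>2. k \<le> m \<and> largest_prime_factor k < largest_prime_factor (k - 1) \<and>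
    (\<forall>j\<in>{k..m}. largest_prime_factor j < largest_prime_factor (Suc j))"
  using assms
proof (induction m rule: nat_induct_at_least)
  case base
  then show ?case using largest_prime_factor_2_3_4
    by (intro exI[of _ 4]) (auto simp: eval_nat_numeral)
next
  case (Suc m)
  consider "largest_prime_factor (Suc m) < largest_prime_factor m"
    | "largest_prime_factor m < largest_prime_factor (Suc m)"
    using largest_prime_factor_Suc_neq[of m] Suc.hyps by linarith
  then show ?case
  proof cases
    case 1
    then show ?thesis using Suc by (intro exI[of _ "Suc m"]) auto
  next
    case 2
    then obtain k where "2 \<le> k" "k \<le> m" "largest_prime_factor k < largest_prime_factor (k - 1)"
      "\<forall>j\<in>{k..m}. largest_prime_factor j < largest_prime_factor (Suc j)"
      using Suc.IH by blast
    then show ?thesis using 2 Suc.prems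
      by (intro exI[of _ k]) (auto simp: le_Suc_eq)
  qed
qed

section \<open>Counting peaks, valleys and block ends\<close>

lemma finite_upto: "finite {n::nat. P n \<and> real n \<le> x \<and> Q n}"
  by (rule finite_subset[of _ "{..nat \<lfloor>x\<rfloor>}"]) (auto simp: le_nat_floor)

lemma finite_peaks_upto [simp]: "finite (peaks_upto x)"
  unfolding peaks_upto_def by (rule finite_upto)

lemma finite_valleys_upto [simp]: "finite (valleys_upto x)"
  unfolding valleys_upto_def by (rule finite_upto)

text \<open>Each peak is sent to the valley at the foot of the ascent leading up to it. A later peak
  with the same foot would have the earlier one on its ascent, where no peak can lie.\<close>

lemma card_peaks_le_card_valleys: "card (peaks_upto x) \<le> card (valleys_upto x) + 5"
proof -
  let ?P = "largest_prime_factor"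
  \<comment> \<open>\<open>descent_to_valley\<close> is applied at \<open>k - 1\<close> and starts
    at 4, so the peaks below 5 are set aside; they are the additive 5.\<close>
  define B where "B = peaks_upto x - {..<5}"
  have "\<exists>j. j \<in> valleys_upto x \<and> j < k \<and> (\<forall>i\<in>{j..<k}. ?P i < ?P (Suc i))"
    if "k \<in> B" for k
  proof -
    have k: "k \<ge> 5" "?P (k - 1) < ?P k" "real k \<le> x"
      using that by (auto simp: B_def peaks_upto_def)
    then obtain j where "j \<ge> 2" "j \<le> k - 1" "?P j < ?P (j - 1)" "\<forall>i\<in>{j..k-1}. ?P i < ?P (Suc i)"
      using descent_to_valley[of "k - 1"] by fastforce
    then show ?thesis using k
      by (intro exI[of _ j]) (auto simp: valleys_upto_def)
  qed
  then obtain v where v: "\<And>k. k \<in> B \<Longrightarrow> v k \<in> valleys_upto x \<and> v k < k \<and>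
      (\<forall>i\<in>{v k..<k}. ?P i < ?P (Suc i))"
    by metis
  have "inj_on v B"
  proof (rule linorder_inj_onI')
    fix k l assume kl: "k \<in> B" "l \<in> B" "k < l"
    show "v k \<noteq> v l"
    proof
      assume "v k = v l"
      then have "?P k < ?P (Suc k)" using v[OF kl(1)] v[OF kl(2)] kl(3) by auto
      moreover have "?P (Suc k) < ?P k" using kl by (auto simp: B_def peaks_upto_def)
      ultimately show False by simp
    qed
  qed
  then have "card B \<le> card (valleys_upto x)"
    using v by (intro card_inj_on_le[of v]) auto
  moreover have "card (peaks_upto x) - card {..<5::nat} \<le> card B"
    unfolding B_def by (rule diff_card_le_card_Diff) auto
  ultimately show ?thesis by simp
qed

text \<open>At the end of a block the largest prime factor drops below the threshold, and the
  descent traced back from there reaches a peak without leaving the block. Different blocks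
  therefore give different peaks.\<close>

lemma card_block_ends_le_card_peaks:
  fixes t :: real and N :: nat
  defines "A \<equiv> {n\<in>{1..N}. t < real (largest_prime_factor n)}"
  assumes "real N \<le> x"
  shows "card {m\<in>A. Suc m \<notin> A} \<le> card (peaks_upto x) + 1"
proof -
  let ?P = "largest_prime_factor"
  \<comment> \<open>At \<open>N\<close> the block may end only because the range is cut off, with no
    descent behind it; this is the \<open>+ 1\<close>.\<close>
  define E where "E = {m\<in>A. Suc m \<notin> A} - {N}"
  have "\<exists>k. k \<in> peaks_upto x \<and> k \<le> m \<and> {k..m} \<subseteq> A" if "m \<in> E" for m
  proof -
    have m: "1 \<le> m" "?P (Suc m) < ?P m" "m \<le> N" "t < real (?P m)"
      using that by (auto simp: E_def A_def)
    then obtain k where k: "k \<ge> 2" "k \<le> m" "?P (k - 1) < ?P k"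
      "\<forall>j\<in>{k..m}. ?P (Suc j) < ?P j \<and> ?P m \<le> ?P j"
      using descent_to_peak[of m] by auto
    have "k \<in> peaks_upto x"
      using k m assms by (auto simp: peaks_upto_def)
    moreover have "{k..m} \<subseteq> A"
      using k m by (force simp: A_def intro: less_le_trans)
    ultimately show ?thesis using k by blast
  qed
  then obtain v where v: "\<And>m. m \<in> E \<Longrightarrow> v m \<in> peaks_upto x \<and> v m \<le> m \<and> {v m..m} \<subseteq> A"
    by metis
  have "inj_on v E"
  proof (rule linorder_inj_onI')
    fix k l assume kl: "k \<in> E" "l \<in> E" "k < l"
    show "v k \<noteq> v l"
    proof
      assume "v k = v l"
      then have "Suc k \<in> A" using v[OF kl(1)] v[OF kl(2)] kl(3) by auto
      then show False using kl(1) by (simp add: E_def)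
    qed
  qed
  then have "card E \<le> card (peaks_upto x)"
    using v by (intro card_inj_on_le[of v]) auto
  moreover have "card {m\<in>A. Suc m \<notin> A} - card {N} \<le> card E"
    unfolding E_def by (rule diff_card_le_card_Diff) auto
  ultimately show ?thesis by simp
qed

text \<open>An element that does not start a run of length \<open>L\<close> lies at most
  \<open>L - 2\<close> before the end of its block, so each end accounts for at most
  \<open>L - 1\<close> elements.\<close>

lemma card_le_block_ends:
  fixes A :: "nat set"
  assumes "finite A"
  shows "card A \<le> (L - 1) * card {m\<in>A. Suc m \<notin> A} + card {n\<in>A. \<forall>i<L. n + i \<in> A}"
proof -
  let ?E = "{m\<in>A. Suc m \<notin> A}" and ?T = "{n\<in>A. \<forall>i<L. n + i \<in> A}"
  have "A \<subseteq> (\<lambda>(m, i). m - i) ` (?E \<times> {..<L - 1}) \<union> ?T"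
  proof
    fix n assume n: "n \<in> A"
    show "n \<in> (\<lambda>(m, i). m - i) ` (?E \<times> {..<L - 1}) \<union> ?T"
    proof (cases "n \<in> ?T")
      case False
      then obtain i where i: "i < L" "n + i \<notin> A" using n by auto
      define j where "j = (LEAST j. n + j \<notin> A)"
      have j: "n + j \<notin> A" unfolding j_def using i(2) by (rule LeastI)
      have "j \<le> i" unfolding j_def using i(2) by (rule Least_le)
      have "j \<noteq> 0" using j n by (intro notI) simp
      then have "n + (j - 1) \<in> A"
        using not_less_Least[of "j - 1" "\<lambda>j. n + j \<notin> A"] unfolding j_def[symmetric] by auto
      then have "(n + (j - 1), j - 1) \<in> ?E \<times> {..<L - 1}"
        using j \<open>j \<noteq> 0\<close> \<open>j \<le> i\<close> i(1) by auto
      then show ?thesis by (intro UnI1) (force intro: image_eqI)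
    qed auto
  qed
  then have "card A \<le> card ((\<lambda>(m, i). m - i) ` (?E \<times> {..<L - 1}) \<union> ?T)"
    using assms by (intro card_mono) auto
  also have "\<dots> \<le> card ((\<lambda>(m, i). m - i) ` (?E \<times> {..<L - 1})) + card ?T"
    by (rule card_Un_le)
  also have "card ((\<lambda>(m, i). m - i) ` (?E \<times> {..<L - 1})) \<le> card (?E \<times> {..<L - 1})"
    using assms by (intro card_image_le) auto
  finally show ?thesis by (simp add: card_cartesian_product mult.commute)
qed

text \<open>Two distinct primes above \<open>t\<close> have a product above \<open>N\<close>, so the
  sets of multiples of the primes in \<open>R\<close> are disjoint and their sizes add up; rounding
  costs at most 1 per prime.\<close>

lemma card_large_prime_factor_ge:
  fixes R :: "nat set"
  assumes fin: "finite R" and prime: "\<And>p. p \<in> R \<Longrightarrow> prime p" and gt: "\<And>p. p \<in> R \<Longrightarrow> t < real p"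
    and sq: "t * t \<ge> real N" "t \<ge> 0"
  shows "real (card {n\<in>{1..N}. t < real (largest_prime_factor n)})
    \<ge> real N * (\<Sum>p\<in>R. 1 / real p) - real (card R)"
proof -
  let ?D = "\<lambda>p. {n\<in>{1..N}. p dvd n}"
  have ppos: "p > 0" if "p \<in> R" for p using prime[OF that] prime_gt_0_nat by blast
  have disj: "?D p \<inter> ?D q = {}" if pq: "p \<in> R" "q \<in> R" "p \<noteq> q" for p q
  proof (rule ccontr)
    assume "?D p \<inter> ?D q \<noteq> {}"
    then obtain n where n: "n \<in> {1..N}" "p dvd n" "q dvd n" by blast
    have "coprime p q" using pq prime primes_coprime by blast
    then have "p * q dvd n" using n by (intro divides_mult)
    then have "p * q \<le> N" using n by (auto dest!: dvd_imp_le)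
    then have "real p * real q \<le> real N" by (metis of_nat_le_iff of_nat_mult)
    moreover have "t * t < real p * real q"
      using gt[OF pq(1)] gt[OF pq(2)] sq(2) by (intro mult_strict_mono) auto
    ultimately show False using sq(1) by linarith
  qed
  have "(\<Sum>p\<in>R. real N * (1 / real p) - 1) \<le> (\<Sum>p\<in>R. real (card (?D p)))"
  proof (intro sum_mono)
    fix p assume "p \<in> R"
    then show "real N * (1 / real p) - 1 \<le> real (card (?D p))"
      using card_shifted_multiples_ge[OF ppos, of p N 0] by simp
  qed
  also have "\<dots> = real (card (\<Union>p\<in>R. ?D p))"
    using fin disj by (subst card_UN_disjoint) auto
  also have "\<dots> \<le> real (card {n\<in>{1..N}. t < real (largest_prime_factor n)})"
  proof -
    have "(\<Union>p\<in>R. ?D p) \<subseteq> {n\<in>{1..N}. t < real (largest_prime_factor n)}"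
    proof
      fix n assume "n \<in> (\<Union>p\<in>R. ?D p)"
      then obtain p where pn: "p \<in> R" "n \<in> {1..N}" "p dvd n" by blast
      then have "p \<le> largest_prime_factor n"
        using prime by (intro prime_le_largest_prime_factor) auto
      then show "n \<in> {n\<in>{1..N}. t < real (largest_prime_factor n)}"
        using gt[OF pn(1)] pn(2) by simp
    qed
    then show ?thesis by (intro of_nat_mono card_mono) auto
  qed
  finally show ?thesis by (simp add: sum_subtractf sum_distrib_left)
qed

text \<open>Put \<open>x = y ^ 10\<close>: an \<open>m \<le> x\<close> with a prime factor above \<open>y ^ 7\<close> has no other prime factor
  above \<open>y ^ 3\<close>.  The window length 50 makes the
  second-moment bound (about \<open>x/10\<close>) smaller than the lower bound \<open>x/5\<close> for \<open>card A\<close>.\<close>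

lemma eventually_card_peaks_upto_ge:
  "\<forall>\<^sub>F x in at_top. 49 * real (card (peaks_upto x)) \<ge> 7 / 100 * x"
proof -
  have filt: "filterlim (\<lambda>x::real. x powr (1/10)) at_top at_top"
  proof -
    have "filterlim (\<lambda>x. exp (1/10 * ln x)) at_top (at_top :: real filter)"
      by (intro filterlim_compose[OF exp_at_top] filterlim_tendsto_pos_mult_at_top[OF tendsto_const] ln_at_top) auto
    moreover have eq: "\<forall>\<^sub>F x :: real in at_top. exp (1/10 * ln x) = x powr (1/10)"
      using eventually_gt_at_top[of 0] by eventually_elim (simp add: powr_def)
    ultimately show ?thesis by (simp only: filterlim_cong[OF refl refl eq])
  qed
  \<comment> \<open>The limits available are 1 - 7/9 = 2/9 and 1 - 3/4 = 1/4; 1/5 lies below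
    both.\<close>
  have "\<forall>\<^sub>F y in at_top. (\<Sum>p\<in>primes_between (y ^ 7) (y ^ 9). 1 / real p) \<ge> 1/5"
    "\<forall>\<^sub>F y in at_top. (\<Sum>p\<in>primes_between (y ^ 3) (y ^ 4). 1 / real p) \<ge> 1/5"
    by (intro eventually_sum_inverse_primes_between_powers_ge; simp)+
  then have "\<forall>\<^sub>F y in at_top. y \<ge> 100 \<and>
      (\<Sum>p\<in>primes_between (y ^ 7) (y ^ 9). 1 / real p) \<ge> 1/5 \<and>
      (\<Sum>p\<in>primes_between (y ^ 3) (y ^ 4). 1 / real p) \<ge> 1/5"
    using eventually_ge_at_top[of 100] by eventually_elim auto
  from eventually_compose_filterlim[OF this filt] eventually_gt_at_top[of 0]
  show ?thesis
  proof eventually_elim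
    case (elim x)
    define y where "y = x powr (1/10)"
    define N where "N = nat \<lfloor>x\<rfloor>"
    define R where "R = primes_between (y ^ 7) (y ^ 9)"
    define Q where "Q = primes_between (y ^ 3) (y ^ 4)"
    define A where "A = {n\<in>{1..N}. y ^ 7 < real (largest_prime_factor n)}"
    define T where "T = {n\<in>A. \<forall>i<50. n + i \<in> A}"
    define \<Lambda> where "\<Lambda> = real 50 * (\<Sum>p\<in>Q. 1 / real p)"
    have y: "y \<ge> 100" and R_ge: "(\<Sum>p\<in>R. 1 / real p) \<ge> 1/5" and Q_ge: "(\<Sum>p\<in>Q. 1 / real p) \<ge> 1/5"
      using elim by (auto simp: y_def R_def Q_def)
    have yx: "y ^ 10 = x" using elim by (simp add: y_def powr_power)
    have N: "real N \<le> x" "x - 1 < real N" using elim unfolding N_def by linarith+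
    have RD: "prime p" "y ^ 7 < real p" if "p \<in> R" for p
      using that by (auto simp: R_def primes_between_def)
    have QD: "prime p" "y ^ 3 < real p" if "p \<in> Q" for p
      using that by (auto simp: Q_def primes_between_def)

    have "real N \<le> y ^ 7 * y ^ 7"
    proof -
      have "y ^ 10 \<le> y ^ 14" using y by (intro power_increasing) auto
      then show ?thesis using N yx by (simp flip: power_add)
    qed
    then have "real N * (\<Sum>p\<in>R. 1 / real p) - real (card R) \<le> real (card A)"
      unfolding A_def using RD y by (intro card_large_prime_factor_ge) (auto simp: R_def)
    moreover have "real N * (1/5) \<le> real N * (\<Sum>p\<in>R. 1 / real p)"
      using R_ge by (intro mult_left_mono) auto
    moreover have "real (card R) \<le> y ^ 9"
      unfolding R_def using y by (intro card_primes_between_le) auto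
    ultimately have card_A: "real N / 5 - y ^ 9 \<le> real (card A)" by linarith

    have \<Lambda>: "\<Lambda> \<ge> 10" using Q_ge by (simp add: \<Lambda>_def)
    have "T \<subseteq> {n\<in>{1..N}. \<forall>i<50. \<forall>p\<in>Q. \<not> p dvd n + i}"
    proof
      fix n assume n: "n \<in> T"
      have "\<not> p dvd n + i" if ip: "i < 50" "p \<in> Q" for i p
      proof
        assume dvd: "p dvd n + i"
        let ?q = "largest_prime_factor (n + i)"
        have m: "n + i \<in> {1..N}" "y ^ 7 < real ?q"
          using n ip by (auto simp: T_def A_def)
        have "y ^ 7 \<ge> 1" using y by simp
        then have "?q \<noteq> 1" using m by auto
        then have "n + i \<ge> 2" using m by (cases "n + i = 1") auto
        note q = largest_prime_factor_prime_dvd[OF this]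
        have "real p \<le> y ^ 4" using ip by (auto simp: Q_def primes_between_def)
        also have "y ^ 4 \<le> y ^ 7" using y by (intro power_increasing) auto
        finally have "p \<noteq> ?q" using m by auto
        then have "p * ?q dvd n + i"
          using q QD[OF ip(2)] dvd by (intro divides_mult) (auto intro: primes_coprime)
        then have "p * ?q \<le> N" using m by (auto dest!: dvd_imp_le)
        then have "real p * real ?q \<le> real N" by (metis of_nat_le_iff of_nat_mult)
        moreover have "y ^ 3 * y ^ 7 < real p * real ?q"
          using QD[OF ip(2)] m y by (intro mult_strict_mono) (auto simp: prime_gt_0_nat)
        ultimately show False using N yx by (simp flip: power_add)
      qed
      then show "n \<in> {n\<in>{1..N}. \<forall>i<50. \<forall>p\<in>Q. \<not> p dvd n + i}"
        using n by (auto simp: T_def A_def)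
    qed
    then have "real (card T) \<le> real (card {n\<in>{1..N}. \<forall>i<50. \<forall>p\<in>Q. \<not> p dvd n + i})"
      by (intro of_nat_mono card_mono) auto
    also have "\<dots> \<le> real N / \<Lambda> + 4 * (real 50 * real (card Q) / \<Lambda>)\<^sup>2"
      unfolding \<Lambda>_def
    proof (rule card_no_prime_factor_in_window_le)
      show "finite Q" by (simp add: Q_def)
      show "prime p" if "p \<in> Q" for p using QD that by blast
      show "50 \<le> p" if "p \<in> Q" for p
      proof -
        have "100 ^ 1 \<le> y ^ 3" using y power_increasing[of 1 3 y] by simp
        then show ?thesis using QD(2)[OF that] by simp
      qed
      show "real 50 * (\<Sum>p\<in>Q. 1 / real p) > 0" using Q_ge by simp
    qed
    also have "real N / \<Lambda> \<le> real N / 10"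
      using \<Lambda> by (intro divide_left_mono) auto
    also have "(real 50 * real (card Q) / \<Lambda>)\<^sup>2 \<le> (5 * y ^ 4)\<^sup>2"
    proof (intro power_mono)
      have "real (card Q) \<le> y ^ 4"
        unfolding Q_def using y by (intro card_primes_between_le) auto
      then have "real 50 * real (card Q) / \<Lambda> \<le> 50 * y ^ 4 / 10"
        using \<Lambda> y by (intro frac_le) auto
      then show "real 50 * real (card Q) / \<Lambda> \<le> 5 * y ^ 4" by simp
    qed (use \<Lambda> in simp)
    finally have card_T: "real (card T) \<le> real N / 10 + 100 * y ^ 8"
      by (simp add: power_mult_distrib flip: power_mult)

    have "card A \<le> 49 * card {m\<in>A. Suc m \<notin> A} + card T"
      using card_le_block_ends[of A 50] by (simp add: A_def T_def)
    also have "\<dots> \<le> 49 * (card (peaks_upto x) + 1) + card T"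
      using card_block_ends_le_card_peaks[OF N(1), of "y ^ 7"] by (simp add: A_def)
    finally have "real (card A) \<le> real (49 * (card (peaks_upto x) + 1) + card T)"
      by (simp only: of_nat_le_iff)
    \<comment> \<open>N/5 - N/10 leaves N/10. The 50 covers the 49 from the extra block end and the
      loss from \<open>x - 1 < N\<close>.\<close>
    then have "49 * real (card (peaks_upto x)) \<ge> x / 10 - y ^ 9 - 100 * y ^ 8 - 50"
      using card_A card_T N by simp
    \<comment> \<open>Since \<open>y \<ge> 100\<close>, each of the three error terms is at most
      x/100, which leaves 7/100 of \<open>x\<close>.\<close>
    moreover have "y ^ 9 \<le> x / 100"
      using y yx mult_right_mono[of 100 y "y ^ 9"] by (simp flip: power_Suc)
    moreover have "100 * y ^ 8 \<le> x / 100"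
    proof -
      have "100 * 100 \<le> y * y" using y by (intro mult_mono) auto
      then have "100 * 100 * y ^ 8 \<le> y * y * y ^ 8" using y by (intro mult_right_mono) auto
      also have "y * y * y ^ 8 = x" by (simp add: eval_nat_numeral flip: yx)
      finally show ?thesis by simp
    qed
    moreover have "50 \<le> x / 100"
    proof -
      have "100 ^ 10 \<le> y ^ 10" using y by (intro power_mono) auto
      then show ?thesis using yx by simp
    qed
    ultimately show ?case by linarith
  qed
qed

theorem theorem1:
  shows "(\<forall>\<^sub>F x :: real in at_top. real (card (valleys_upto x)) > 1.063 / 10 ^ 7 * x) \<and>
         (\<forall>\<^sub>F x :: real in at_top. real (card (peaks_upto x)) > 8.84 / 10 ^ 4 * x)"
proof
  \<comment> \<open>Dividing by 49 gives the density 1/700, above both constants; beyond 10000 the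
    loss of 5 in passing to valleys is harmless.\<close>
  show "\<forall>\<^sub>F x :: real in at_top. real (card (valleys_upto x)) > 1.063 / 10 ^ 7 * x"
    using eventually_card_peaks_upto_ge eventually_gt_at_top[of 10000]
  proof eventually_elim
    case (elim x)
    have "real (card (peaks_upto x)) \<le> real (card (valleys_upto x)) + 5"
      using card_peaks_le_card_valleys[of x] by linarith
    then show ?case using elim by simp
  qed
  show "\<forall>\<^sub>F x :: real in at_top. real (card (peaks_upto x)) > 8.84 / 10 ^ 4 * x"
    using eventually_card_peaks_upto_ge eventually_gt_at_top[of 0]
    by eventually_elim simp
qed

end
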